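(* Let $\phi:R\rightarrow R'$ be a morphism of commutative rings which lifts idempotents. Then every countable set $\{e'_{1},e'_{2},e'_{3},\ldots\}$ of orthogonal idempotents of $R'$ can be lifted to a set $\{e_{1},e_{2},e_{3},\ldots\}$ of orthogonal idempotents of $R$, i.e., with $\phi(e_{i})=e'_{i}$ for all $i$.
   Context: All rings are commutative with $1$. A morphism of rings $\phi:R\rightarrow R'$ lifts idempotents if for every idempotent $e'\in R'$ there exists an idempotent $e\in R$ with $\phi(e)=e'$. A subset $A$ of a ring is a set of orthogonal idempotents if each member of $A$ is idempotent and the product of any two distinct members of $A$ is $0$. In the listings $\{e'_1,e'_2,\ldots\}$, different indices denote distinct elements. *)

theory Defs
  imports "HOL-Algebra.Ring" "HOL-Library.Countable_Set"
begin

definition idempotent_elem :: "('a, 'm) ring_scheme \<Rightarrow> 'a \<Rightarrow> bool" where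
  "idempotent_elem R e \<longleftrightarrow> e \<in> carrier R \<and> e \<otimes>\<^bsub>R\<^esub> e = e"

definition orthogonal_idempotents :: "('a, 'm) ring_scheme \<Rightarrow> 'a set \<Rightarrow> bool" where
  "orthogonal_idempotents R A \<longleftrightarrow>
     (\<forall>e\<in>A. idempotent_elem R e) \<and>
     (\<forall>e\<in>A. \<forall>f\<in>A. e \<noteq> f \<longrightarrow> e \<otimes>\<^bsub>R\<^esub> f = \<zero>\<^bsub>R\<^esub>)"

definition lifts_idempotents ::
  "('a, 'm) ring_scheme \<Rightarrow> ('b, 'n) ring_scheme \<Rightarrow> ('a \<Rightarrow> 'b) \<Rightarrow> bool" where
  "lifts_idempotents R R' \<phi> \<longleftrightarrow>
     (\<forall>e'. idempotent_elem R' e' \<longrightarrow> (\<exists>e. idempotent_elem R e \<and> \<phi> e = e'))"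

end

(* Enumerate the given idempotents, lift each one to an idempotent h n, and put
   e n = h n * (1 - h 0) * ... * (1 - h (n - 1)).
   The e n are orthogonal because h i * (1 - h i) = 0, and e n still lifts the n-th
   idempotent because that one absorbs 1 - e' for every e' orthogonal to it. *)
theory Submission
  imports Defs
begin

primrec prod_compl :: "('a, 'm) ring_scheme \<Rightarrow> (nat \<Rightarrow> 'a) \<Rightarrow> nat \<Rightarrow> 'a" where
  "prod_compl R h 0 = \<one>\<^bsub>R\<^esub>"
| "prod_compl R h (Suc n) = prod_compl R h n \<otimes>\<^bsub>R\<^esub> (\<one>\<^bsub>R\<^esub> \<ominus>\<^bsub>R\<^esub> h n)"

context cring
begin

lemma idempotent_mult:
  assumes "idempotent_elem R a" "idempotent_elem R b"
  shows "idempotent_elem R (a \<otimes> b)"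
proof -
  have c: "a \<in> carrier R" "b \<in> carrier R" "a \<otimes> a = a" "b \<otimes> b = b"
    using assms by (auto simp: idempotent_elem_def)
  have "(a \<otimes> b) \<otimes> (a \<otimes> b) = (a \<otimes> a) \<otimes> (b \<otimes> b)"
    using c(1,2) by (simp add: m_ac)
  then show ?thesis using c by (simp add: idempotent_elem_def)
qed

lemma idempotent_mult_compl:
  assumes "idempotent_elem R a"
  shows "a \<otimes> (\<one> \<ominus> a) = \<zero>"
  using assms by (simp add: idempotent_elem_def a_minus_def r_distr r_minus r_neg)

lemma idempotent_compl:
  assumes "idempotent_elem R a"
  shows "idempotent_elem R (\<one> \<ominus> a)"
proof -
  have c: "a \<in> carrier R" using assms by (simp add: idempotent_elem_def)
  \<comment> \<open>Only the left factor is expanded, so that the subtracted term vanishes by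
    \<open>idempotent_mult_compl\<close>.\<close>
  have "(\<one> \<ominus> a) \<otimes> (\<one> \<ominus> a) = (\<one> \<ominus> a) \<ominus> a \<otimes> (\<one> \<ominus> a)"
    using c by (simp add: a_minus_def l_distr l_minus)
  then show ?thesis
    using c idempotent_mult_compl[OF assms] by (simp add: idempotent_elem_def a_minus_def)
qed

lemma idempotent_prod_compl:
  assumes "\<And>n. idempotent_elem R (h n)"
  shows "idempotent_elem R (prod_compl R h n)"
  by (induction n)
    (use assms in \<open>auto simp: idempotent_elem_def[of _ \<one>] intro: idempotent_mult idempotent_compl\<close>)

text \<open>For \<open>i < n\<close> the complement of \<open>h i\<close> is one of the factors, and
  \<open>h i\<close> annihilates it. In the induction it is either the newest factor or already
  handled by the induction hypothesis.\<close>

lemma mult_prod_compl_zero: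
  assumes h: "\<And>n. idempotent_elem R (h n)" and "i < n"
  shows "h i \<otimes> prod_compl R h n = \<zero>"
  using \<open>i < n\<close>
proof (induction n)
  case (Suc n)
  have c: "h k \<in> carrier R" "prod_compl R h n \<in> carrier R" for k
    using h idempotent_prod_compl[OF h] by (auto simp: idempotent_elem_def)
  show ?case
  proof (cases "i = n")
    case True
    have "h n \<otimes> (prod_compl R h n \<otimes> (\<one> \<ominus> h n))
        = prod_compl R h n \<otimes> (h n \<otimes> (\<one> \<ominus> h n))"
      using c by (simp add: m_lcomm)
    then show ?thesis using True c by (simp add: idempotent_mult_compl[OF h])
  next
    case False
    have "h i \<otimes> (prod_compl R h n \<otimes> (\<one> \<ominus> h n))
        = (h i \<otimes> prod_compl R h n) \<otimes> (\<one> \<ominus> h n)"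
      using c by (simp add: m_assoc)
    then show ?thesis using False Suc c by simp
  qed
qed simp

lemma orthogonal_mult_prod_compl:
  assumes h: "\<And>n. idempotent_elem R (h n)" and "m \<noteq> n"
  shows "(h m \<otimes> prod_compl R h m) \<otimes> (h n \<otimes> prod_compl R h n) = \<zero>"
proof -
  have c: "h k \<in> carrier R" "prod_compl R h k \<in> carrier R" for k
    using h idempotent_prod_compl[OF h] by (auto simp: idempotent_elem_def)
  \<comment> \<open>Exchanging the two products pairs each \<open>h\<close> with the product of the
    other index; the pair whose \<open>h\<close> has the smaller index is zero.\<close>
  have "(h m \<otimes> prod_compl R h m) \<otimes> (h n \<otimes> prod_compl R h n)
      = (h m \<otimes> prod_compl R h n) \<otimes> (h n \<otimes> prod_compl R h m)"
    using c by (simp add: m_ac)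
  then show ?thesis
    using c \<open>m \<noteq> n\<close> mult_prod_compl_zero[of h m n, OF h]
      mult_prod_compl_zero[of h n m, OF h]
    by (cases m n rule: linorder_cases) auto
qed

text \<open>Each factor fixes \<open>x\<close>, since subtracting
  \<open>x \<otimes> h i = \<zero>\<close> changes nothing. The bound \<open>i < n\<close> allows
  \<open>x\<close> to be \<open>h n\<close> itself. Carrier membership is proved alongside because
  reassociating in the induction step needs it.\<close>

lemma mult_prod_compl_absorb:
  assumes "x \<in> carrier R" "\<And>i. h i \<in> carrier R" "\<And>i. i < n \<Longrightarrow> x \<otimes> h i = \<zero>"
  shows "prod_compl R h n \<in> carrier R \<and> x \<otimes> prod_compl R h n = x"
  using assms(3)
proof (induction n)
  case (Suc n)
  then have IH: "prod_compl R h n \<in> carrier R" "x \<otimes> prod_compl R h n = x"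
    by auto
  have "x \<otimes> (prod_compl R h n \<otimes> (\<one> \<ominus> h n)) = x \<otimes> (\<one> \<ominus> h n)"
    using IH assms(1,2) by (simp flip: m_assoc)
  also have "\<dots> = x"
    using Suc.prems[of n] assms(1,2) by (simp add: a_minus_def r_distr r_minus)
  finally show ?case using IH assms(2) by simp
qed (use assms(1) in simp)

end

lemma (in ring_hom_cring) hom_prod_compl:
  assumes "\<And>n. f n \<in> carrier R"
  shows "prod_compl R f n \<in> carrier R \<and> h (prod_compl R f n) = prod_compl S (h \<circ> f) n"
  by (induction n) (use assms in \<open>auto simp: a_minus_def\<close>)

theorem theorem5p1:
  fixes R :: "('a, 'm) ring_scheme" and R' :: "('b, 'n) ring_scheme"
    and \<phi> :: "'a \<Rightarrow> 'b" and E' :: "'b set"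
  assumes "cring R" and "cring R'"
    and "\<phi> \<in> ring_hom R R'"
    and "lifts_idempotents R R' \<phi>"
    and "countable E'"
    and "orthogonal_idempotents R' E'"
  shows "\<exists>E e. bij_betw e E' E \<and> orthogonal_idempotents R E \<and> (\<forall>e'\<in>E'. \<phi> (e e') = e')"
proof -
  interpret ring_hom_cring R R' \<phi>
    using assms(1-3) by (simp add: ring_hom_cring_def ring_hom_cring_axioms_def)
  \<comment> \<open>Any injection into the naturals will do: the order in which the idempotents are
    treated is immaterial.\<close>
  define \<nu> where "\<nu> = to_nat_on E'"
  have inj: "inj_on \<nu> E'"
    using assms(5) by (simp add: \<nu>_def inj_on_to_nat_on)
  \<comment> \<open>Indices outside the range of the enumeration are padded with zero,
    so that finite and infinite sets are treated alike.\<close>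
  define a where "a n = (if n \<in> \<nu> ` E' then inv_into E' \<nu> n else \<zero>\<^bsub>R'\<^esub>)" for n
  have a_\<nu>: "a (\<nu> x) = x" if "x \<in> E'" for x
    using that inj by (simp add: a_def)
  have a_idem: "idempotent_elem R' (a n)" for n
    using assms(6)
    by (auto simp: a_def inj orthogonal_idempotents_def idempotent_elem_def)
  have a_orth: "a m \<otimes>\<^bsub>R'\<^esub> a n = \<zero>\<^bsub>R'\<^esub>" if "m \<noteq> n" for m n
  proof (cases "m \<in> \<nu> ` E' \<and> n \<in> \<nu> ` E'")
    case True
    then obtain x y where "m = \<nu> x" "n = \<nu> y" "x \<in> E'" "y \<in> E'" by blast
    moreover from this that have "x \<noteq> y" by blast
    ultimately show ?thesis
      using assms(6) by (simp add: a_\<nu> orthogonal_idempotents_def)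
  next
    \<comment> \<open>At least one of the two indices is padding, so one factor is zero.\<close>
    case False
    then show ?thesis
      using a_idem[of m] a_idem[of n] by (auto simp: a_def idempotent_elem_def)
  qed
  \<comment> \<open>The lifts are chosen independently of each other, so distinct ones are
    orthogonal only modulo the kernel of \<open>\<phi>\<close>.\<close>
  have "\<forall>n. \<exists>e. idempotent_elem R e \<and> \<phi> e = a n"
    using assms(4) a_idem by (simp add: lifts_idempotents_def)
  then obtain f where f: "\<And>n. idempotent_elem R (f n)" and \<phi>f: "\<And>n. \<phi> (f n) = a n"
    by metis
  have fc: "f n \<in> carrier R" for n
    using f by (simp add: idempotent_elem_def)
  define e where "e n = f n \<otimes>\<^bsub>R\<^esub> prod_compl R f n" for n
  have \<phi>e: "\<phi> (e n) = a n" for n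
  proof -
    have "\<phi> (e n) = a n \<otimes>\<^bsub>R'\<^esub> prod_compl R' a n"
      using hom_prod_compl[of f n, OF fc] fc by (simp add: e_def \<phi>f comp_def)
    then show ?thesis
      \<comment> \<open>Absorption is applied in \<open>R'\<close>, where orthogonality of the
        \<open>a i\<close> is already known.\<close>
      using S.mult_prod_compl_absorb[of "a n" a n] a_idem a_orth
      by (simp add: idempotent_elem_def)
  qed
  have lift: "\<phi> (e (\<nu> x)) = x" if "x \<in> E'" for x
    using that by (simp add: \<phi>e a_\<nu>)
  have "inj_on (\<lambda>x. e (\<nu> x)) E'"
    \<comment> \<open>Distinct elements have distinct lifts because \<open>\<phi>\<close> recovers
      each element from its lift.\<close>
    by (rule inj_on_inverseI[of _ \<phi>]) (rule lift)
  then have "bij_betw (\<lambda>x. e (\<nu> x)) E' ((\<lambda>x. e (\<nu> x)) ` E')"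
    by (rule inj_on_imp_bij_betw)
  moreover have "orthogonal_idempotents R ((\<lambda>x. e (\<nu> x)) ` E')"
    unfolding orthogonal_idempotents_def
  proof (intro conjI ballI impI)
    fix y assume "y \<in> (\<lambda>x. e (\<nu> x)) ` E'"
    then show "idempotent_elem R y"
      using R.idempotent_mult[OF f R.idempotent_prod_compl[of f, OF f]] by (auto simp: e_def)
  next
    fix y z
    assume "y \<in> (\<lambda>x. e (\<nu> x)) ` E'" "z \<in> (\<lambda>x. e (\<nu> x)) ` E'" "y \<noteq> z"
    then obtain m n where "y = e m" "z = e n" by auto
    \<comment> \<open>Orthogonality is known by index, so distinct values are first traced back to
      distinct indices.\<close>
    moreover from this \<open>y \<noteq> z\<close> have "m \<noteq> n" by blast
    ultimately show "y \<otimes>\<^bsub>R\<^esub> z = \<zero>\<^bsub>R\<^esub>"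
      using R.orthogonal_mult_prod_compl[of f, OF f] by (simp add: e_def)
  qed
  ultimately show ?thesis using lift by blast
qed

end
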